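(* Let $\mathcal H$ be a real Hilbert space, $A:\mathcal H\to\mathcal H$ single-valued and continuously differentiable, $B:\mathcal H\rightrightarrows 2^{\mathcal H}$ maximal monotone, and suppose the solution set $\mathcal S=\{x: 0\in (A+B)(x)\}$ is nonempty. Consider a sequence $\{x_t\}$ generated by the inexact damped Newton-like scheme described in the context with parameters $c>0$ and $\nu,\rho\ge 0$. Assume that for some $\epsilon>0$, $\kappa>0$ and $q>0$ the error bound $$\operatorname{dist}(x,\mathcal S)\le \kappa\, r(x)^q\qquad \forall x\in V:=\{x : r(x)\le \epsilon\}$$ holds, and that within $V$, $A$ is $L$-Lipschitz continuous for some $L\ge 0$ and $\nabla A$ is $p$-Hölder continuous for some $p\in(0,1]$ (i.e. $\|\nabla A(x)-\nabla A(y)\|\le \zeta\|x-y\|^p$ for all $x,y\in V$, for some $\zeta\ge0$). Suppose that $$(1+p)q>1,\qquad (q+pq-\rho)(1+p)>1,\qquad \rho+q>1,\qquad \rho>0 .$$ Then, if $r_0$ is sufficiently small, $\{r_t\}$ converges $Q$-superlinearly to $0$ within $V$ according to $$r_{t+1}=O\left(r_t^{1+\bar s}\right),\qquad \bar s:=\min\{(1+p)q,\ (q+pq-\rho)(1+p),\ \rho+q,\ 1+\rho\}-1>0,$$ and moreover $\{d_t\}$ converges $R$-superlinearly to $0$ within $V$.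
   Context: Notation: $\mathrm{Id}$ is the identity on $\mathcal H$; $R(x):=x-(\mathrm{Id}+B)^{-1}(\mathrm{Id}-A)(x)$, $r(x):=\|R(x)\|$, so that $\mathcal S=\{x: R(x)=0\}$; $\operatorname{dist}(x,\mathcal S)$ is the distance from $x$ to $\mathcal S$. Along a sequence $\{x_t\}$: $r_t:=r(x_t)$, $d_t:=\operatorname{dist}(x_t,\mathcal S)$. The scheme: at iterate $x_t$, put $\mu_t:=c\,r(x_t)^\rho$, and $H_t:=\mu_t\mathrm{Id}+J_t$, where $J_t$ is a bounded linear operator on $\mathcal H$ that is positive semidefinite ($\langle J_t v,v\rangle\ge 0$ for all $v$) but possibly non-Hermitian and satisfies $\|J_t-\nabla A(x_t)\|=O(r(x_t)^\theta)$ for some $\theta\ge\rho$ (with constant independent of $t$). Define the subproblem residual $$\hat r_t(x):=\left\|x-(\mathrm{Id}+B)^{-1}\big((\mathrm{Id}-H_t)(x)+(H_t-A)(x_t)\big)\right\|,$$ which vanishes at the exact step $(H_t+B)^{-1}(H_t-A)(x_t)$. The next iterate $x_{t+1}$ is any point satisfying $\hat r_t(x_{t+1})\le \nu\, r(x_t)^{1+\rho}$. The iteration is stopped if $r(x_t)=0$ (then $x_t\in\mathcal S$), so $r(x_t)>0$ whenever a step is taken. $\sigma_t=O(\tau_t)$ means $\sigma_t\le\beta\tau_t$ for some $\beta>0$ independent of $t$, for all $t$ sufficiently large. A nonnegative sequence converges $R$-superlinearly to $0$ if it is dominated termwise by a sequence converging $Q$-superlinearly to $0$; "within $V$" means that the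 iterates remain in $V$. *)

theory Defs
  imports "HOL-Analysis.Analysis" "HOL-Library.Landau_Symbols"
begin

definition monotone_op :: "('a::real_inner \<Rightarrow> 'a set) \<Rightarrow> bool" where
  "monotone_op B \<longleftrightarrow> (\<forall>x y. \<forall>u\<in>B x. \<forall>v\<in>B y. 0 \<le> inner (u - v) (x - y))"

definition maximal_monotone :: "('a::real_inner \<Rightarrow> 'a set) \<Rightarrow> bool" where
  "maximal_monotone B \<longleftrightarrow> monotone_op B \<and>
     (\<forall>C. monotone_op C \<and> (\<forall>x. B x \<subseteq> C x) \<longrightarrow> C = B)"

(* The value at z of (Id + B)^{-1}.  For a maximal monotone B on a Hilbert space the
   description is uniquely satisfied for every z (Minty). *)
definition resolvent :: "('a::real_inner \<Rightarrow> 'a set) \<Rightarrow> 'a \<Rightarrow> 'a" where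
  "resolvent B z = (THE y. z \<in> (\<lambda>b. y + b) ` B y)"

definition solutions :: "('a::real_inner \<Rightarrow> 'a) \<Rightarrow> ('a \<Rightarrow> 'a set) \<Rightarrow> 'a set" where
  "solutions A B = {x. 0 \<in> (\<lambda>b. A x + b) ` B x}"

definition residual :: "('a::real_inner \<Rightarrow> 'a) \<Rightarrow> ('a \<Rightarrow> 'a set) \<Rightarrow> 'a \<Rightarrow> real" where
  "residual A B x = norm (x - resolvent B (x - A x))"

definition damped ::
  "('a::real_inner \<Rightarrow> 'a) \<Rightarrow> ('a \<Rightarrow> 'a set) \<Rightarrow> real \<Rightarrow> real \<Rightarrow> 'a \<Rightarrow> ('a \<Rightarrow>\<^sub>L 'a) \<Rightarrow> ('a \<Rightarrow>\<^sub>L 'a)" where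
  "damped A B c \<rho> z J = (c * residual A B z powr \<rho>) *\<^sub>R id_blinfun + J"

(* z is the current iterate, H the operator used there. *)
definition sub_residual ::
  "('a::real_inner \<Rightarrow> 'a) \<Rightarrow> ('a \<Rightarrow> 'a set) \<Rightarrow> ('a \<Rightarrow>\<^sub>L 'a) \<Rightarrow> 'a \<Rightarrow> 'a \<Rightarrow> real" where
  "sub_residual A B H z x =
     norm (x - resolvent B ((x - blinfun_apply H x) + (blinfun_apply H z - A z)))"

(* Sequences generated by the scheme.  DA is the derivative of A, and K is the constant
   in norm (J t - DA (x t)) = O(r (x t)^\<theta>).  A run that stops at x t (residual 0)
   is continued by the constant x t, and J is unconstrained from there on. *)
definition newton_like_sequence ::
  "('a::real_inner \<Rightarrow> 'a) \<Rightarrow> ('a \<Rightarrow> 'a \<Rightarrow>\<^sub>L 'a) \<Rightarrow> ('a \<Rightarrow> 'a set) \<Rightarrow>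
   real \<Rightarrow> real \<Rightarrow> real \<Rightarrow> real \<Rightarrow> real \<Rightarrow> (nat \<Rightarrow> 'a \<Rightarrow>\<^sub>L 'a) \<Rightarrow> (nat \<Rightarrow> 'a) \<Rightarrow> bool" where
  "newton_like_sequence A DA B c \<nu> \<rho> \<theta> K J x \<longleftrightarrow>
     (\<forall>t. if residual A B (x t) = 0 then x (Suc t) = x t
          else (\<forall>v. 0 \<le> inner (blinfun_apply (J t) v) v) \<and>
               norm (J t - DA (x t)) \<le> K * residual A B (x t) powr \<theta> \<and>
               sub_residual A B (damped A B c \<rho> (x t) (J t)) (x t) (x (Suc t))
                 \<le> \<nu> * residual A B (x t) powr (1 + \<rho>))"

(* The little-o form of "\<sigma> (t+1) / \<sigma> t tends to 0"; it remains meaningful when \<sigma> has zeros. *)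
definition Q_superlinear :: "(nat \<Rightarrow> real) \<Rightarrow> bool" where
  "Q_superlinear \<sigma> \<longleftrightarrow>
     (\<forall>t. 0 \<le> \<sigma> t) \<and> \<sigma> \<longlonglongrightarrow> 0 \<and> (\<lambda>t. \<sigma> (Suc t)) \<in> o(\<sigma>)"

definition R_superlinear :: "(nat \<Rightarrow> real) \<Rightarrow> bool" where
  "R_superlinear \<sigma> \<longleftrightarrow> (\<exists>\<tau>. Q_superlinear \<tau> \<and> (\<forall>t. 0 \<le> \<sigma> t \<and> \<sigma> t \<le> \<tau> t))"

definition sbar :: "real \<Rightarrow> real \<Rightarrow> real \<Rightarrow> real" where
  "sbar p q \<rho> = Min {(1 + p) * q, (q + p * q - \<rho>) * (1 + p), \<rho> + q, 1 + \<rho>} - 1"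

end

theory Submission imports Defs "HOL-Real_Asymp.Real_Asymp"
begin

text \<open>By Minty's theorem the resolvent is nonexpansive, so the residual \<open>r\<close> is \<open>(2 + L)\<close>-Lipschitz on
  \<open>V\<close>.  Comparing one step with a solution \<open>xs\<close> at distance \<open>O(r\<^sup>q)\<close>, monotonicity of \<open>B\<close> and the
  damping \<open>c r\<^sup>\<rho>\<close> bound the step length by \<open>O(r\<^sup>q + r powr (q + p q - \<rho>))\<close>; nonexpansiveness of the
  resolvent and Taylor's formula then bound the next residual by
  \<open>O(r powr (1 + \<rho>) + r\<^sup>\<rho> \<parallel>x' - x\<parallel> + \<parallel>x' - x\<parallel> powr (1 + p))\<close>, whose exponents are the four in
  \<open>sbar\<close>.\<close>

section \<open>Maximal monotone operators and Minty's theorem\<close>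

lemma monotone_opD:
  "monotone_op B \<Longrightarrow> u \<in> B x \<Longrightarrow> v \<in> B y \<Longrightarrow> 0 \<le> inner (u - v) (x - y)"
  by (auto simp: monotone_op_def)

text \<open>Adding \<open>u\<close> to the values at \<open>x\<close> keeps the operator monotone,
  so maximality forces \<open>u\<close> to be there already.\<close>

lemma maximal_monotone_memI:
  assumes "maximal_monotone B" and rel: "\<And>y b. b \<in> B y \<Longrightarrow> 0 \<le> inner (b - u) (y - x)"
  shows "u \<in> B x"
proof -
  define C where "C = B(x := insert u (B x))"
  have "0 \<le> inner (u - b) (x - y)" if "b \<in> B y" for y b
    using rel[OF that] by (simp add: algebra_simps)
  then have "monotone_op C"
    using assms unfolding C_def monotone_op_def maximal_monotone_def by auto
  moreover have "\<forall>x. B x \<subseteq> C x"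
    by (auto simp: C_def)
  ultimately have "C = B"
    using assms(1) unfolding maximal_monotone_def by blast
  then show ?thesis
    by (metis C_def fun_upd_same insertI1)
qed

text \<open>The convex hull of this set lies in the epigraph of the largest convex function bounded
  by the pairing on the graph of \<open>B\<close>; the conjugate of that function is the Fitzpatrick
  function.\<close>

definition graph_lift :: "('a::real_inner \<Rightarrow> 'a set) \<Rightarrow> ('a \<times> 'a \<times> real) set" where
  "graph_lift B = {(y, b, inner b y) | y b. b \<in> B y}"

lemma convex_affine_ge:
  fixes f :: "'a::real_vector \<Rightarrow> real"
  assumes "linear f"
  shows "convex {x. f x + k \<ge> 0}"
proof (rule convexI)
  fix x y u v :: real and a b :: 'a
  assume *: "a \<in> {x. f x + k \<ge> 0}" "b \<in> {x. f x + k \<ge> 0}" "0 \<le> u" "0 \<le> v" "u + v = 1"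
  have "f (u *\<^sub>R a + v *\<^sub>R b) + k = u * (f a + k) + v * (f b + k)"
  proof -
    have "k = u * k + v * k"
      using *(5) by (simp flip: distrib_right)
    then show ?thesis
      by (simp add: linear_add[OF assms] linear_cmul[OF assms] algebra_simps)
  qed
  then show "u *\<^sub>R a + v *\<^sub>R b \<in> {x. f x + k \<ge> 0}"
    using * by simp
qed

text \<open>On two lifted points \<open>?F\<close> is the monotonicity pairing
  \<open>inner (b - b') (y - y')\<close>. It is affine in each argument, so its sign passes to the
  hull one argument at a time; on the diagonal it equals \<open>2 * (s - inner b y)\<close>.\<close>

lemma hull_graph_lift_ge:
  fixes B :: "'a::real_inner \<Rightarrow> 'a set"
  assumes "monotone_op B" and "(y, b, s) \<in> convex hull (graph_lift B)"
  shows "inner b y \<le> s"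
proof -
  let ?F = "\<lambda>(y :: 'a) (b :: 'a) (s :: real) (y', b', s'). s + s' - inner b y' - inner b' y"
  have lin: "linear (\<lambda>(y', b', s' :: real). s' - inner b y' - inner b' y)" for b y :: 'a
    by (rule linearI) (auto simp: algebra_simps)
  have conv: "convex {w. 0 \<le> ?F y b s w}" for y b s
    using convex_affine_ge[OF lin[of b y], of s] by (simp add: case_prod_unfold algebra_simps)
  have base: "0 \<le> ?F y b s w" if "(y, b, s) \<in> graph_lift B" "w \<in> graph_lift B" for y b s w
    using that monotone_opD[OF assms(1)]
    by (fastforce simp: graph_lift_def algebra_simps inner_commute)
  have half: "0 \<le> ?F y b s w" if "(y, b, s) \<in> graph_lift B" "w \<in> convex hull (graph_lift B)" for y b s w
  proof -
    have "convex hull (graph_lift B) \<subseteq> {w. 0 \<le> ?F y b s w}"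
      using base[OF that(1)] by (intro hull_minimal conv) blast
    then show ?thesis using that(2) by blast
  qed
  have "graph_lift B \<subseteq> {w. 0 \<le> ?F y b s w}"
    using half[OF _ assms(2)] by (fastforce simp: inner_commute)
  then have "convex hull (graph_lift B) \<subseteq> {w. 0 \<le> ?F y b s w}"
    using conv by (rule hull_minimal)
  then show ?thesis
    using assms(2) by auto
qed

lemma Cauchy_of_sq_dist_le:
  fixes w :: "nat \<Rightarrow> 'a::real_normed_vector"
  assumes le: "\<And>m n. norm (w m - w n) ^ 2 \<le> e m + e n" and e: "e \<longlonglongrightarrow> (0::real)"
  shows "Cauchy w"
proof (rule metric_CauchyI)
  fix d :: real assume "d > 0"
  then have "\<forall>\<^sub>F n in sequentially. e n < d ^ 2 / 2"
    by (intro order_tendstoD(2)[OF e]) simp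
  then obtain N where N: "\<And>n. n \<ge> N \<Longrightarrow> e n < d ^ 2 / 2"
    by (auto simp: eventually_sequentially)
  have "dist (w m) (w n) < d" if "m \<ge> N" "n \<ge> N" for m n
  proof -
    have "norm (w m - w n) ^ 2 < d ^ 2"
      using le[of m n] N[OF that(1)] N[OF that(2)] by linarith
    then show ?thesis
      using \<open>d > 0\<close> by (simp add: dist_norm power2_less_imp_less)
  qed
  then show "\<exists>N. \<forall>m\<ge>N. \<forall>n\<ge>N. dist (w m) (w n) < d" by blast
qed

text \<open>First-order condition at a minimum: divide by \<open>t\<close> and let \<open>t\<close>
  tend to 0.\<close>

lemma nonneg_slope:
  fixes a b :: real
  assumes "\<And>t. 0 < t \<Longrightarrow> t \<le> 1 \<Longrightarrow> 0 \<le> t * a + t ^ 2 * b"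
  shows "0 \<le> a"
proof (rule tendsto_lowerbound)
  show "((\<lambda>t. a + t * b) \<longlongrightarrow> a) (at_right 0)"
    by (auto intro!: tendsto_eq_intros)
  have "0 \<le> a + t * b" if "0 < t" "t < 1" for t
    using assms[of t] that by (simp add: power2_eq_square mult.assoc zero_le_mult_iff flip: distrib_left)
  then show "\<forall>\<^sub>F t in at_right 0. 0 \<le> a + t * b"
    by (auto simp: eventually_at_right_field intro!: exI[of _ 1])
qed auto

text \<open>With an empty graph the condition of \<open>maximal_monotone_memI\<close> is vacuous and
  puts a point into the graph.\<close>

lemma maximal_monotone_nonempty:
  assumes "maximal_monotone B"
  shows "\<exists>y b. b \<in> B y"
  using maximal_monotone_memI[OF assms] by blast

text \<open>A zero of \<open>Id + B\<close> is a point \<open>w\<close> with \<open>inner (w + b) (w - y) \<le> 0\<close> on the graph.  The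
  infimum of \<open>\<parallel>y - b\<parallel>\<^sup>2 / 4 + s\<close> over the convex hull of all \<open>(y, b, inner b y)\<close> is the dual of
  finding such a \<open>w\<close>: a minimising sequence makes \<open>(y - b) / 2\<close> Cauchy by strong convexity, and the
  variational inequality at the limit is the required one.\<close>

lemma Minty_zero:
  fixes B :: "'a::{real_inner, complete_space} \<Rightarrow> 'a set"
  assumes "maximal_monotone B"
  shows "\<exists>w. - w \<in> B w"
proof -
  define Q where "Q = convex hull (graph_lift B)"
  define half where "half = (\<lambda>(y, b, s :: real). (1/2) *\<^sub>R (y - b :: 'a))"
  define val where "val = (\<lambda>(y :: 'a, b :: 'a, s :: real). s)"
  define h where "h = (\<lambda>P. norm (half P) ^ 2 + val P)"
  have lin: "half (u *\<^sub>R P + v *\<^sub>R P') = u *\<^sub>R half P + v *\<^sub>R half P'"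
      "val (u *\<^sub>R P + v *\<^sub>R P') = u * val P + v * val P'" for u v P P'
    by (auto simp: half_def val_def case_prod_unfold algebra_simps)
  have mono: "monotone_op B"
    using assms by (simp add: maximal_monotone_def)
  \<comment> \<open>By polarization \<open>norm (half P) ^ 2\<close> and the pairing add up to a
    square. The resulting \<open>0 \<le> m\<close> closes the final inequality.\<close>
  have h_nonneg: "0 \<le> h P" if "P \<in> Q" for P
  proof -
    obtain y b s where P: "P = (y, b, s)" by (cases P)
    have "inner b y \<le> s"
      using hull_graph_lift_ge[OF mono] that P unfolding Q_def by blast
    moreover have "norm ((1/2) *\<^sub>R (y - b)) ^ 2 + inner b y = norm ((1/2) *\<^sub>R (y + b)) ^ 2"
      by (simp add: power2_norm_eq_inner inner_simps inner_commute field_simps)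
    ultimately show ?thesis
      using zero_le_power2[of "norm ((1/2) *\<^sub>R (y + b))"]
      unfolding P h_def half_def val_def prod.case by linarith
  qed
  have "Q \<noteq> {}"
    using maximal_monotone_nonempty[OF assms] by (auto simp: Q_def graph_lift_def)
  define m where "m = Inf (h ` Q)"
  have bdd: "bdd_below (h ` Q)"
    using h_nonneg by (auto intro!: bdd_belowI)
  have m_le: "m \<le> h P" if "P \<in> Q" for P
    unfolding m_def using bdd that by (simp add: cInf_lower)
  have "0 \<le> m"
    unfolding m_def using h_nonneg \<open>Q \<noteq> {}\<close> by (intro cInf_greatest) auto
  have Qc: "u *\<^sub>R P + v *\<^sub>R P' \<in> Q" if "P \<in> Q" "P' \<in> Q" "0 \<le> u" "0 \<le> v" "u + v = 1" for u v P P'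
    using that convex_convex_hull[of "graph_lift B"] unfolding Q_def convex_def by blast
  have "\<exists>P\<in>Q. h P < m + 1 / real (Suc n)" for n
    using cInf_lessD[of "h ` Q" "m + 1 / real (Suc n)"] \<open>Q \<noteq> {}\<close> by (auto simp: m_def)
  then obtain P where PQ: "\<And>n. P n \<in> Q" and Ph: "\<And>n. h (P n) < m + 1 / real (Suc n)"
    by metis
  have inv: "(\<lambda>n. 1 / real (Suc n)) \<longlonglongrightarrow> 0"
    using LIMSEQ_inverse_real_of_nat by (simp add: inverse_eq_divide)
  have h_lim: "(\<lambda>n. h (P n)) \<longlonglongrightarrow> m"
  proof (rule tendsto_sandwich[OF _ _ tendsto_const])
    show "(\<lambda>n. m + 1 / real (Suc n)) \<longlonglongrightarrow> m"
      using tendsto_add[OF tendsto_const inv, of m] by simp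
  qed (use m_le[OF PQ] Ph in \<open>auto intro!: always_eventually less_imp_le\<close>)
  \<comment> \<open>Parallelogram law at the midpoint, which stays in \<open>Q\<close> and so has
    value at least \<open>m\<close>.\<close>
  have "norm (half (P i) - half (P j)) ^ 2 \<le> 2 * (1 / real (Suc i)) + 2 * (1 / real (Suc j))" for i j
  proof -
    have "m \<le> h ((1/2) *\<^sub>R P i + (1/2) *\<^sub>R P j)"
      by (intro m_le Qc PQ) auto
    also have "\<dots> = (h (P i) + h (P j)) / 2 - norm (half (P i) - half (P j)) ^ 2 / 4"
      unfolding h_def lin by (simp add: power2_norm_eq_inner inner_simps inner_commute field_simps)
    finally show ?thesis
      using Ph[of i] Ph[of j] by argo
  qed
  moreover have "(\<lambda>n. 2 * (1 / real (Suc n))) \<longlonglongrightarrow> 0"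
    using tendsto_mult[OF tendsto_const inv, of 2] by simp
  ultimately have "Cauchy (\<lambda>n. half (P n))"
    by (rule Cauchy_of_sq_dist_le)
  then obtain w where w: "(\<lambda>n. half (P n)) \<longlonglongrightarrow> w"
    using Cauchy_convergent convergent_def by blast
  \<comment> \<open>No limit of \<open>P n\<close> itself is claimed: \<open>h\<close> depends only
    on \<open>half\<close> and \<open>val\<close>, and these converge along the sequence.\<close>
  have val_lim: "(\<lambda>n. val (P n)) \<longlonglongrightarrow> m - norm w ^ 2"
    using tendsto_diff[OF h_lim tendsto_power[OF tendsto_norm[OF w], of 2]] by (simp add: h_def)
  have "- w \<in> B w"
  proof (rule maximal_monotone_memI[OF assms])
    fix y b assume "b \<in> B y"
    define P0 where "P0 = (y, b, inner b y)"
    have P0: "P0 \<in> Q"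
      unfolding Q_def by (rule hull_inc) (use \<open>b \<in> B y\<close> in \<open>auto simp: P0_def graph_lift_def\<close>)
    let ?v = "half P0"
    \<comment> \<open>Compare \<open>m\<close> with \<open>h\<close> on the segment from
      \<open>P n\<close> to \<open>P0\<close>, for fixed \<open>t\<close>, and pass to the limit in
      \<open>n\<close>. The slope in \<open>t\<close> is extracted afterwards.\<close>
    have "0 \<le> t * (2 * inner w ?v - norm w ^ 2 + val P0 - m) + t ^ 2 * norm (?v - w) ^ 2"
      if "0 < t" "t \<le> 1" for t
    proof -
      have "(\<lambda>n. h ((1 - t) *\<^sub>R P n + t *\<^sub>R P0))
          \<longlonglongrightarrow> norm ((1 - t) *\<^sub>R w + t *\<^sub>R ?v) ^ 2 + ((1 - t) * (m - norm w ^ 2) + t * val P0)"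
        unfolding h_def lin by (intro tendsto_intros w val_lim)
      moreover have "m \<le> h ((1 - t) *\<^sub>R P n + t *\<^sub>R P0)" for n
        using that by (intro m_le Qc PQ P0) auto
      ultimately have "m \<le> norm ((1 - t) *\<^sub>R w + t *\<^sub>R ?v) ^ 2 + ((1 - t) * (m - norm w ^ 2) + t * val P0)"
        by (intro LIMSEQ_le_const) auto
      moreover have "(1 - t) *\<^sub>R w + t *\<^sub>R ?v = w + t *\<^sub>R (?v - w)"
        by (simp add: algebra_simps)
      moreover have "norm (w + t *\<^sub>R (?v - w)) ^ 2
          = norm w ^ 2 + 2 * t * inner w (?v - w) + t ^ 2 * norm (?v - w) ^ 2"
        unfolding power2_norm_eq_inner
        by (simp add: inner_add_left inner_add_right inner_commute[of "?v - w" w] power2_eq_square distrib_left)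
      moreover have "inner w (?v - w) = inner w ?v - norm w ^ 2"
        by (simp add: power2_norm_eq_inner inner_diff_right)
      ultimately show ?thesis
        by (simp add: algebra_simps)
    qed
    then have "0 \<le> 2 * inner w ?v - norm w ^ 2 + val P0 - m"
      by (rule nonneg_slope)
    \<comment> \<open>This pairing exceeds the slope just bounded by exactly
      \<open>m\<close>.\<close>
    then show "0 \<le> inner (b - - w) (y - w)"
      using \<open>0 \<le> m\<close> unfolding P0_def half_def val_def
      by (simp add: power2_norm_eq_inner inner_simps inner_commute algebra_simps)
  qed
  then show ?thesis by blast
qed

text \<open>Shifting all values of \<open>B\<close> by \<open>- z\<close> preserves maximal
  monotonicity and turns the claim into \<open>Minty_zero\<close>.\<close>

theorem Minty:
  fixes B :: "'a::{real_inner, complete_space} \<Rightarrow> 'a set"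
  assumes "maximal_monotone B"
  shows "\<exists>y. z - y \<in> B y"
proof -
  let ?C = "\<lambda>y. (\<lambda>b. b - z) ` B y"
  have "maximal_monotone ?C"
    unfolding maximal_monotone_def
  proof (intro conjI allI impI)
    show "monotone_op ?C"
      using assms by (auto simp: maximal_monotone_def monotone_op_def)
    fix D assume D: "monotone_op D \<and> (\<forall>x. ?C x \<subseteq> D x)"
    have "d + z \<in> B x" if "d \<in> D x" for d x
    proof (rule maximal_monotone_memI[OF assms])
      fix y b assume "b \<in> B y"
      then have "b - z \<in> D y" using D by auto
      then show "0 \<le> inner (b - (d + z)) (y - x)"
        using monotone_opD[of D "b - z" y d x] D that by (simp add: algebra_simps)
    qed
    then have "d \<in> ?C x" if "d \<in> D x" for d x
      using that by (intro image_eqI[of _ _ "d + z"]) auto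
    then show "D = ?C" using D by blast
  qed
  then obtain w where "- w \<in> ?C w"
    using Minty_zero by blast
  then have "z - w \<in> B w" by (auto simp: algebra_simps)
  then show ?thesis by blast
qed

section \<open>Resolvent, solutions and zero residual\<close>

lemma resolvent_unique_lipschitz:
  assumes "monotone_op B" "z - y \<in> B y" "z' - y' \<in> B y'"
  shows "norm (y - y') \<le> norm (z - z')"
proof -
  \<comment> \<open>This is firm nonexpansiveness. Arguing about points instead of
    \<open>resolvent\<close> lets the same estimate give uniqueness, and with it the
    \<open>THE\<close> in the definition of \<open>resolvent\<close>.\<close>
  have "norm (y - y') ^ 2 \<le> inner (z - z') (y - y')"
    using monotone_opD[OF assms] by (simp add: power2_norm_eq_inner algebra_simps)
  also have "\<dots> \<le> norm (z - z') * norm (y - y')"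
    by (rule norm_cauchy_schwarz)
  finally show ?thesis
    by (cases "y = y'") (auto simp: power2_eq_square)
qed

lemma resolvent_eqI:
  assumes "monotone_op B" "z - y \<in> B y"
  shows "resolvent B z = y"
  unfolding resolvent_def
proof (rule the_equality)
  show "z \<in> (\<lambda>b. y + b) ` B y"
    using assms(2) by (intro image_eqI[of _ _ "z - y"]) auto
  fix y' assume "z \<in> (\<lambda>b. y' + b) ` B y'"
  then have "z - y' \<in> B y'" by auto
  then show "y' = y"
    using resolvent_unique_lipschitz[OF assms(1) _ assms(2)] by fastforce
qed

lemma resolvent_mem:
  fixes B :: "'a::{real_inner, complete_space} \<Rightarrow> 'a set"
  assumes "maximal_monotone B"
  shows "z - resolvent B z \<in> B (resolvent B z)"
  using Minty[OF assms, of z] resolvent_eqI[of B z] assms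
  by (auto simp: maximal_monotone_def)

lemma resolvent_nonexpansive:
  fixes B :: "'a::{real_inner, complete_space} \<Rightarrow> 'a set"
  assumes "maximal_monotone B"
  shows "norm (resolvent B z - resolvent B z') \<le> norm (z - z')"
  using resolvent_unique_lipschitz resolvent_mem[OF assms] assms
  unfolding maximal_monotone_def by blast

lemma solutions_iff: "x \<in> solutions A B \<longleftrightarrow> - A x \<in> B x"
  by (force simp: solutions_def image_iff add_eq_0_iff)

lemma residual_eq_0_of_solution:
  assumes "monotone_op B" "x \<in> solutions A B"
  shows "residual A B x = 0"
  using resolvent_eqI[OF assms(1), of "x - A x" x] assms(2) by (simp add: residual_def solutions_iff)

section \<open>Powers of small numbers and superlinear sequences\<close>

lemma sbar_bounds:
  "1 + sbar p q \<rho> \<le> (1 + p) * q" "1 + sbar p q \<rho> \<le> (q + p * q - \<rho>) * (1 + p)"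
  "1 + sbar p q \<rho> \<le> \<rho> + q" "1 + sbar p q \<rho> \<le> 1 + \<rho>"
  by (simp_all add: sbar_def)

text \<open>The smallness conditions on the residual in the step estimates are brought to this
  shape, so no explicit thresholds have to be computed.\<close>

lemma eventually_add_powr_less:
  fixes a k e :: real
  assumes "0 < k" "0 < e"
  shows "\<forall>\<^sub>F r in at_right 0. r + a * r powr k < e"
proof -
  have "((\<lambda>r::real. r powr k) \<longlongrightarrow> 0) (at_right 0)"
    using assms by real_asymp
  then have "((\<lambda>r. r + a * r powr k) \<longlongrightarrow> 0) (at_right 0)"
    using tendsto_add[OF tendsto_ident_at tendsto_mult[OF tendsto_const]] by fastforce
  then show ?thesis
    using assms(2) order_tendstoD(2) by blast
qed

lemma add_powr_le:
  fixes a b k :: real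
  assumes "0 \<le> a" "0 \<le> b" "0 \<le> k"
  shows "(a + b) powr k \<le> 2 powr k * (a powr k + b powr k)"
proof -
  have "(a + b) powr k \<le> (2 * max a b) powr k"
    using assms by (intro powr_mono2) auto
  also have "\<dots> = 2 powr k * max a b powr k"
    using assms by (simp add: powr_mult)
  also have "\<dots> \<le> 2 powr k * (a powr k + b powr k)"
    by (intro mult_left_mono) (auto simp: max_def)
  finally show ?thesis .
qed

text \<open>Halving gives geometric convergence to 0; then the ratio of successive terms is at most
  \<open>C * r t powr s\<close>, which tends to 0.\<close>

lemma Q_superlinear_powr_rate:
  fixes r :: "nat \<Rightarrow> real"
  assumes nonneg: "\<And>t. 0 \<le> r t" and half: "\<And>t. r (Suc t) \<le> r t / 2"
    and rate: "\<And>t. r (Suc t) \<le> C * r t powr (1 + s)" and "0 < s"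
  shows "Q_superlinear r"
proof -
  have le: "r t \<le> r 0 * (1/2) ^ t" for t
  proof (induction t)
    case (Suc t)
    then show ?case using half[of t] by simp
  qed simp
  have lim: "r \<longlonglongrightarrow> 0"
  proof (rule tendsto_sandwich[OF _ _ tendsto_const])
    have "(\<lambda>t. (1/2 :: real) ^ t) \<longlonglongrightarrow> 0"
      by (rule LIMSEQ_realpow_zero) auto
    then show "(\<lambda>t. r 0 * (1/2) ^ t) \<longlonglongrightarrow> 0"
      using tendsto_mult[OF tendsto_const] by fastforce
  qed (use nonneg le in auto)
  have "(\<lambda>t. r t powr s) \<longlonglongrightarrow> 0"
    using tendsto_zero_powrI[OF lim tendsto_const] nonneg \<open>0 < s\<close> by simp
  then have powr_lim: "(\<lambda>t. C * r t powr s) \<longlonglongrightarrow> 0"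
    using tendsto_mult[OF tendsto_const, of _ 0 _ C] by simp
  have "(\<lambda>t. r (Suc t)) \<in> o(r)"
  proof (rule landau_o.smallI)
    fix k :: real assume "0 < k"
    with powr_lim have "\<forall>\<^sub>F t in sequentially. C * r t powr s < k"
      by (intro order_tendstoD(2)) auto
    then show "\<forall>\<^sub>F t in sequentially. norm (r (Suc t)) \<le> k * norm (r t)"
    proof eventually_elim
      case (elim t)
      have "r (Suc t) \<le> (C * r t powr s) * r t"
        using rate[of t] nonneg[of t] by (simp add: powr_add mult_ac)
      also have "\<dots> \<le> k * r t"
        using elim nonneg[of t] by (intro mult_right_mono) auto
      finally show ?case using nonneg by simp
    qed
  qed
  then show ?thesis
    using nonneg lim by (simp add: Q_superlinear_def)
qed

text \<open>Through the error bound this supplies the sequence dominating the distances to the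
  solution set.\<close>

lemma Q_superlinear_powr:
  assumes "Q_superlinear r" "0 < q" "0 < k"
  shows "Q_superlinear (\<lambda>t. k * r t powr q)"
proof -
  have nonneg: "\<And>t. 0 \<le> r t" and lim: "r \<longlonglongrightarrow> 0" and o: "(\<lambda>t. r (Suc t)) \<in> o(r)"
    using assms(1) by (auto simp: Q_superlinear_def)
  have "(\<lambda>t. r t powr q) \<longlonglongrightarrow> 0"
    using tendsto_zero_powrI[OF lim tendsto_const] nonneg \<open>0 < q\<close> by simp
  then have "(\<lambda>t. k * r t powr q) \<longlonglongrightarrow> 0"
    using tendsto_mult[OF tendsto_const, of _ 0 _ k] by simp
  moreover have "(\<lambda>t. k * r (Suc t) powr q) \<in> o(\<lambda>t. k * r t powr q)"
  proof (rule landau_o.smallI)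
    fix e :: real assume "0 < e"
    \<comment> \<open>The factor \<open>e powr (1/q)\<close> becomes \<open>e\<close> after raising
      to the power \<open>q\<close>.\<close>
    then have "\<forall>\<^sub>F t in sequentially. norm (r (Suc t)) \<le> e powr (1/q) * norm (r t)"
      by (intro landau_o.smallD[OF o]) auto
    then show "\<forall>\<^sub>F t in sequentially. norm (k * r (Suc t) powr q) \<le> e * norm (k * r t powr q)"
    proof eventually_elim
      case (elim t)
      then have "r (Suc t) powr q \<le> (e powr (1/q) * r t) powr q"
        using nonneg \<open>0 < q\<close> by (intro powr_mono2) auto
      also have "\<dots> = e * r t powr q"
        using nonneg \<open>0 < q\<close> \<open>0 < e\<close> by (simp add: powr_mult powr_powr)
      finally show ?case using \<open>0 < k\<close> by simp
    qed
  qed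
  ultimately show ?thesis
    using \<open>0 < k\<close> by (simp add: Q_superlinear_def)
qed

section \<open>Regularity of the residual and of \<open>A\<close> around points of
  \<open>V\<close>\<close>

locale newton_setting =
  fixes A :: "'a::{real_inner, complete_space} \<Rightarrow> 'a"
    and DA :: "'a \<Rightarrow> 'a \<Rightarrow>\<^sub>L 'a"
    and B :: "'a \<Rightarrow> 'a set"
    and V :: "'a set"
    and \<epsilon> L p \<zeta> :: real
  assumes deriv: "\<And>x. (A has_derivative blinfun_apply (DA x)) (at x)"
    and maxmono: "maximal_monotone B"
    and V: "V = {x. residual A B x \<le> \<epsilon>}"
    and lip: "L-lipschitz_on V A"
    and p_pos: "0 < p" and zeta_nonneg: "0 \<le> \<zeta>"
    and Holder: "\<And>x y. x \<in> V \<Longrightarrow> y \<in> V \<Longrightarrow> norm (DA x - DA y) \<le> \<zeta> * norm (x - y) powr p"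
begin

abbreviation r where "r \<equiv> residual A B"

lemma mono: "monotone_op B"
  using maxmono by (simp add: maximal_monotone_def)

lemma L_nonneg: "0 \<le> L"
  using lip lipschitz_on_nonneg by blast

lemma r_nonneg: "0 \<le> r x"
  by (simp add: residual_def)

lemma A_diff_le: "u \<in> V \<Longrightarrow> w \<in> V \<Longrightarrow> norm (A u - A w) \<le> L * norm (u - w)"
  using lipschitz_onD[OF lip] by (simp add: dist_norm)

text \<open>The map \<open>x - A x\<close> is \<open>(1 + L)\<close>-Lipschitz on \<open>V\<close>,
  the resolvent does not increase this, and the identity adds 1.\<close>

lemma residual_lipschitz:
  assumes "u \<in> V" "w \<in> V"
  shows "r w \<le> r u + (2 + L) * norm (u - w)"
proof -
  let ?P = "\<lambda>x. resolvent B (x - A x)"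
  have "norm (?P u - ?P w) \<le> norm ((u - A u) - (w - A w))"
    by (rule resolvent_nonexpansive[OF maxmono])
  also have "\<dots> \<le> norm (u - w) + norm (A u - A w)"
    using norm_triangle_ineq4[of "u - w" "A u - A w"] by (simp add: algebra_simps)
  also have "\<dots> \<le> (1 + L) * norm (u - w)"
    using A_diff_le[OF assms] by (simp add: algebra_simps)
  finally have 1: "norm (?P u - ?P w) \<le> (1 + L) * norm (u - w)" .
  have "w - ?P w = (u - ?P u) + ((?P u - ?P w) - (u - w))" by simp
  then have "r w \<le> r u + norm ((?P u - ?P w) - (u - w))"
    unfolding residual_def by (metis norm_triangle_ineq)
  also have "\<dots> \<le> r u + (norm (?P u - ?P w) + norm (u - w))"
    using norm_triangle_ineq4 by simp
  finally show ?thesis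
    using 1 by (simp add: algebra_simps)
qed

text \<open>Continuity is wanted on the whole space, because it is applied to segments that may
  leave \<open>V\<close>.\<close>

lemma continuous_residual: "continuous_on UNIV r"
proof -
  have "continuous_on UNIV (resolvent B)"
    by (rule lipschitz_on_continuous_on[OF lipschitz_onI[of _ _ 1]])
      (use resolvent_nonexpansive[OF maxmono] in \<open>auto simp: dist_norm\<close>)
  moreover have "continuous_on UNIV (\<lambda>x. x - A x)"
    using has_derivative_continuous[OF deriv]
    by (intro continuous_intros) (simp add: continuous_on_eq_continuous_at)
  ultimately have "continuous_on UNIV (\<lambda>x. resolvent B (x - A x))"
    by (rule continuous_on_compose2) auto
  then show ?thesis
    unfolding residual_def by (intro continuous_intros)
qed

text \<open>\<open>V\<close> need not be convex.  But along a segment starting in \<open>V\<close> the residual grows at most at rate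
  \<open>2 + L\<close> as long as the segment stays in \<open>V\<close>, so by continuity a short segment cannot leave \<open>V\<close>.\<close>

lemma near_in_V:
  assumes "r u + (2 + L) * norm (u - w) < \<epsilon>"
  shows "w \<in> V"
proof (rule ccontr)
  assume "w \<notin> V"
  let ?\<gamma> = "\<lambda>t. u + t *\<^sub>R (w - u)"
  have "0 \<le> (2 + L) * norm (u - w)" using L_nonneg by simp
  then have u: "r u < \<epsilon>" using assms by linarith
  have "continuous_on {0..1} (\<lambda>t. r (?\<gamma> t))"
    by (rule continuous_on_compose2[OF continuous_residual]) (auto intro!: continuous_intros)
  moreover have "\<epsilon> \<le> r (?\<gamma> 1)" using \<open>w \<notin> V\<close> by (simp add: V)
  \<comment> \<open>A point with residual exactly \<epsilon> still belongs to \<open>V\<close>, so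
    \<open>residual_lipschitz\<close> applies there and gives the contradiction.\<close>
  ultimately obtain t where t: "0 \<le> t" "t \<le> 1" "r (?\<gamma> t) = \<epsilon>"
    using IVT'[of "\<lambda>t. r (?\<gamma> t)" 0 \<epsilon> 1] u by auto
  then have "\<epsilon> \<le> r u + (2 + L) * norm (u - ?\<gamma> t)"
    using residual_lipschitz[of u "?\<gamma> t"] u by (simp add: V)
  also have "norm (u - ?\<gamma> t) = t * norm (u - w)"
    using t(1) by (simp add: norm_minus_commute)
  also have "(2 + L) * (t * norm (u - w)) \<le> (2 + L) * norm (u - w)"
    using L_nonneg t by (intro mult_left_mono mult_left_le_one_le) auto
  finally show False using assms by linarith
qed

lemma Taylor:
  assumes small: "r u + (2 + L) * norm (u - w) < \<epsilon>"
  shows "norm (A w - A u - DA u (w - u)) \<le> \<zeta> * norm (w - u) powr (1 + p)"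
proof -
  let ?S = "{y. norm (u - y) \<le> norm (u - w)}"
  have in_V: "y \<in> V" if "y \<in> ?S" for y
  proof (rule near_in_V[of u])
    have "(2 + L) * norm (u - y) \<le> (2 + L) * norm (u - w)"
      using that L_nonneg by (intro mult_left_mono) auto
    then show "r u + (2 + L) * norm (u - y) < \<epsilon>" using small by linarith
  qed
  have "norm (A w - A u - DA u (w - u)) \<le> norm (w - u) * (\<zeta> * norm (w - u) powr p)"
  proof (rule differentiable_bound_linearization[where S = ?S and f' = "\<lambda>x. blinfun_apply (DA x)"])
    show "u + t *\<^sub>R (w - u) \<in> ?S" if "t \<in> {0..1}" for t
      using that by (auto simp: norm_minus_commute mult_left_le_one_le)
    show "(A has_derivative DA x) (at x within ?S)" for x
      using deriv by (rule has_derivative_at_withinI)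
    show "onorm (blinfun_apply (DA x) - blinfun_apply (DA u)) \<le> \<zeta> * norm (w - u) powr p" if "x \<in> ?S" for x
    proof -
      have "onorm (blinfun_apply (DA x) - blinfun_apply (DA u)) \<le> norm (DA x - DA u)"
        by (rule onorm_bound) (simp_all add: norm_blinfun fun_diff_def flip: blinfun.diff_left)
      also have "\<dots> \<le> \<zeta> * norm (x - u) powr p"
        using that in_V by (intro Holder) auto
      also have "\<dots> \<le> \<zeta> * norm (w - u) powr p"
        using that p_pos zeta_nonneg by (intro mult_left_mono powr_mono2) (auto simp: norm_minus_commute)
      finally show ?thesis .
    qed
  qed auto
  then show ?thesis
    by (cases "w = u") (simp_all add: powr_add mult_ac)
qed

text \<open>The Lipschitz constant of \<open>A\<close> is available only on \<open>V\<close>, so the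
  derivative is bounded on short vectors \<open>e\<close>: the increment contributes
  \<open>L\<close>, and the Taylor remainder \<zeta> because \<open>norm e \<le> 1\<close>.\<close>

lemma DA_bound:
  assumes small: "r x + (2 + L) * norm e < \<epsilon>" and "norm e \<le> 1"
  shows "norm (DA x e) \<le> (L + \<zeta>) * norm e"
proof -
  have *: "r x + (2 + L) * norm (x - (x + e)) < \<epsilon>" using small by simp
  have "0 \<le> (2 + L) * norm e" using L_nonneg by simp
  then have "x \<in> V" using small by (simp add: V)
  then have "norm (A (x + e) - A x) \<le> L * norm e"
    using A_diff_le[OF near_in_V[OF *], of x] by simp
  moreover have "norm (A (x + e) - A x - DA x e) \<le> \<zeta> * norm e powr (1 + p)"
    using Taylor[OF *] by simp
  moreover have "norm e powr (1 + p) \<le> norm e powr 1"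
    using assms(2) p_pos by (intro powr_mono') auto
  then have "\<zeta> * norm e powr (1 + p) \<le> \<zeta> * norm e"
    using zeta_nonneg by (intro mult_left_mono) auto
  moreover have "norm (DA x e) \<le> norm (A (x + e) - A x) + norm (A (x + e) - A x - DA x e)"
    using norm_triangle_ineq4[of "A (x + e) - A x" "A (x + e) - A x - DA x e"] by simp
  ultimately show ?thesis by (simp add: algebra_simps)
qed

end

section \<open>Estimates for one step, and convergence of the scheme\<close>

locale newton_scheme = newton_setting A DA B V \<epsilon> L p \<zeta>
  for A :: "'a::{real_inner, complete_space} \<Rightarrow> 'a"
    and DA :: "'a \<Rightarrow> 'a \<Rightarrow>\<^sub>L 'a"
    and B :: "'a \<Rightarrow> 'a set"
    and V :: "'a set"
    and \<epsilon> L p \<zeta> :: real +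
  fixes c \<nu> \<rho> \<theta> K \<kappa> q :: real
  assumes sol: "solutions A B \<noteq> {}"
    and pos: "0 < c" "0 \<le> \<nu>" "0 < \<rho>" "\<rho> \<le> \<theta>" "0 < K" "0 < \<epsilon>" "0 < \<kappa>" "0 < q"
    and error_bound: "\<And>x. x \<in> V \<Longrightarrow> infdist x (solutions A B) \<le> \<kappa> * r x powr q"
    and rates: "(1 + p) * q > 1" "(q + p * q - \<rho>) * (1 + p) > 1" "\<rho> + q > 1"
begin

text \<open>The branch of \<open>newton_like_sequence\<close> with nonzero residual, detached from
  any run, so that constants can be chosen uniformly over all runs.\<close>

definition step :: "'a \<Rightarrow> 'a \<Rightarrow>\<^sub>L 'a \<Rightarrow> 'a \<Rightarrow> bool" where
  "step x J x' \<longleftrightarrow> (\<forall>v. 0 \<le> inner (J v) v) \<and> norm (J - DA x) \<le> K * r x powr \<theta> \<and>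
     sub_residual A B (damped A B c \<rho> x J) x x' \<le> \<nu> * r x powr (1 + \<rho>)"

lemma damped_apply: "damped A B c \<rho> x J v = (c * r x powr \<rho>) *\<^sub>R v + J v"
  by (simp add: damped_def blinfun.add_left blinfun.scaleR_left)

text \<open>For residuals at most 1 the exponent \<theta> may be lowered to \<rho>, which makes the
  error of \<open>J\<close> comparable to the damping.\<close>

lemma J_approx:
  assumes "step x J x'" "r x \<le> 1"
  shows "norm (J v - DA x v) \<le> K * r x powr \<rho> * norm v"
proof -
  have "r x powr \<theta> \<le> r x powr \<rho>"
    using assms(2) r_nonneg pos by (intro powr_mono') auto
  then have "K * r x powr \<theta> \<le> K * r x powr \<rho>"
    using pos by simp
  then have *: "norm (J - DA x) \<le> K * r x powr \<rho>"
    using assms(1) unfolding step_def by linarith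
  have "norm (J v - DA x v) \<le> norm (J - DA x) * norm v"
    using norm_blinfun[of "J - DA x" v] by (simp add: blinfun.diff_left)
  also have "\<dots> \<le> K * r x powr \<rho> * norm v"
    using * by (intro mult_right_mono) auto
  finally show ?thesis .
qed

text \<open>Monotonicity of \<open>B\<close> between \<open>y\<close> (the resolvent point of the subproblem, so that \<open>e = x' - y\<close>
  is its residual) and a solution \<open>xs\<close>, together with the strong monotonicity of the damped operator.\<close>

lemma damped_distance:
  fixes x x' xs :: 'a and J :: "'a \<Rightarrow>\<^sub>L 'a"
  defines "\<mu> \<equiv> c * r x powr \<rho>"
  defines "H \<equiv> blinfun_apply (damped A B c \<rho> x J)"
  defines "y \<equiv> resolvent B ((x' - H x') + (H x - A x))"
  defines "e \<equiv> x' - y"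
  assumes psd: "\<And>v. 0 \<le> inner (J v) v" and xs: "xs \<in> solutions A B"
  shows "\<mu> * norm (y - xs) \<le> norm e + norm (H e) + \<mu> * norm (x - xs)
      + norm (J (x - xs) - DA x (x - xs)) + norm (A xs - A x - DA x (xs - x))"
proof -
  have H: "H v = \<mu> *\<^sub>R v + J v" for v
    by (simp add: H_def \<mu>_def damped_apply)
  have Hdiff: "H (u - v) = H u - H v" for u v
    by (simp add: H_def blinfun.diff_right)
  let ?w = "y - xs"
  \<comment> \<open>\<open>DA x (x - xs)\<close> is subtracted and added back, so that in
    \<open>?g\<close>, apart from \<open>H e\<close>, \<open>J\<close> enters only through its error
    and \<open>A\<close> through its Taylor remainder.\<close>
  let ?g = "e - H e + \<mu> *\<^sub>R (x - xs) + (J (x - xs) - DA x (x - xs)) + (A xs - A x - DA x (xs - x))"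
  have "0 \<le> inner (((x' - H x') + (H x - A x) - y) - (- A xs)) (y - xs)"
    unfolding y_def
    by (rule monotone_opD[OF mono resolvent_mem[OF maxmono]]) (use xs in \<open>simp add: solutions_iff\<close>)
  also have "((x' - H x') + (H x - A x) - y) - (- A xs) = ?g - H ?w"
    by (simp add: e_def Hdiff H blinfun.diff_right algebra_simps)
  finally have "inner (H ?w) ?w \<le> inner ?g ?w"
    by (simp add: inner_diff_left)
  moreover have "\<mu> * norm ?w ^ 2 \<le> inner (H ?w) ?w"
    using psd[of ?w] by (simp add: H inner_add_left power2_norm_eq_inner)
  moreover have "inner ?g ?w \<le> norm ?g * norm ?w"
    by (rule norm_cauchy_schwarz)
  ultimately have "(\<mu> * norm ?w) * norm ?w \<le> norm ?g * norm ?w"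
    by (simp add: power2_eq_square mult.assoc)
  then have "\<mu> * norm ?w \<le> norm ?g"
    by (cases "norm ?w = 0") auto
  also have "\<dots> \<le> norm e + norm (H e) + norm (\<mu> *\<^sub>R (x - xs))
      + norm (J (x - xs) - DA x (x - xs)) + norm (A xs - A x - DA x (xs - x))"
    by (intro order_trans[OF norm_triangle_ineq] add_right_mono norm_triangle_ineq4)
  also have "norm (\<mu> *\<^sub>R (x - xs)) = \<mu> * norm (x - xs)"
    using pos r_nonneg by (simp add: \<mu>_def)
  finally show ?thesis .
qed

text \<open>Divide \<open>damped_distance\<close> by the damping \<open>c * s powr \<rho>\<close>:
  the Taylor remainder, of order \<open>s powr ((1 + p) * q)\<close>, produces the exponent
  \<open>q + p * q - \<rho>\<close>, and all other terms are of order
  \<open>s powr q\<close>.\<close>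

lemma step_length:
  "\<exists>M>0. \<forall>\<^sub>F s in at_right 0. \<forall>x J x'. r x = s \<and> step x J x' \<longrightarrow>
     norm (x' - x) \<le> M * (s powr q + s powr (q + p * q - \<rho>))"
proof -
  \<comment> \<open>The distance need not be attained; doubling \<kappa> leaves room for a solution
    \<open>xs\<close> strictly within \<open>D * s powr q\<close>. \<open>E\<close> bounds the
    inexactness and \<open>N\<close> collects the terms of order \<open>s powr q\<close> before the
    division by \<open>c\<close>.\<close>
  define D where "D = 2 * \<kappa>"
  define E where "E = \<nu> * ((2 + L) * D)"
  define N where "N = (1 + c + K + L + \<zeta>) * E + (c + K) * D"
  define M where "M = E + D + N / c + \<zeta> * D powr (1 + p) / c"
  have nonneg: "0 < D" "0 \<le> E" "0 \<le> N"
    using pos L_nonneg zeta_nonneg by (auto simp: D_def E_def N_def intro!: add_nonneg_nonneg)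
  have "0 < M"
    unfolding M_def using nonneg pos zeta_nonneg
    by (intro add_pos_nonneg add_nonneg_pos) auto
  moreover have "\<forall>\<^sub>F s in at_right 0. \<forall>x J x'. r x = s \<and> step x J x' \<longrightarrow>
     norm (x' - x) \<le> M * (s powr q + s powr (q + p * q - \<rho>))"
  proof -
    have ev1: "\<forall>\<^sub>F s in at_right 0. s + ((2 + L) * D) * s powr q < \<epsilon>"
      using pos by (intro eventually_add_powr_less) auto
    have ev2: "\<forall>\<^sub>F s in at_right 0. s + ((2 + L) * \<nu>) * s powr 1 < \<epsilon>"
      using pos by (intro eventually_add_powr_less) auto
    have ev3: "\<forall>\<^sub>F s in at_right 0. s + \<nu> * s powr 1 < 1"
      by (intro eventually_add_powr_less) auto
    have ev4: "\<forall>\<^sub>F s::real in at_right 0. 0 < s"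
      by (rule eventually_at_right_less)
    from ev1 ev2 ev3 ev4 show ?thesis
    proof eventually_elim
      case (elim s)
      have s: "0 < s" "s \<le> 1" "\<nu> * s \<le> 1"
        using elim pos by (auto simp: mult_nonneg_nonneg intro: order_trans[of _ "s + \<nu> * s"])
      have sV: "s + (2 + L) * (D * s powr q) < \<epsilon>" "s + (2 + L) * (\<nu> * s) < \<epsilon>"
        using elim by (simp_all add: mult.assoc)
      show ?case
      proof (intro allI impI, elim conjE)
        fix x J x' assume rx: "r x = s" and st: "step x J x'"
        define H where "H = blinfun_apply (damped A B c \<rho> x J)"
        define y where "y = resolvent B ((x' - H x') + (H x - A x))"
        define e where "e = x' - y"
        define \<mu> where "\<mu> = c * s powr \<rho>"
        have "0 \<le> (2 + L) * (D * s powr q)"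
          using L_nonneg nonneg by simp
        then have "x \<in> V" using sV(1) rx by (simp add: V)
        have "infdist x (solutions A B) \<le> \<kappa> * s powr q"
          using error_bound[OF \<open>x \<in> V\<close>] rx by simp
        also have "\<dots> < D * s powr q"
          using pos s by (simp add: D_def)
        finally obtain xs where xs: "xs \<in> solutions A B" and dxs: "norm (x - xs) < D * s powr q"
          using sol unfolding infdist_notempty[OF sol]
          by (metis bdd_below_image_dist cINF_less_iff dist_norm)
        have small_xs: "r x + (2 + L) * norm (x - xs) < \<epsilon>"
        proof -
          have "(2 + L) * norm (x - xs) \<le> (2 + L) * (D * s powr q)"
            using dxs L_nonneg by (intro mult_left_mono) auto
          then show ?thesis using sV(1) rx by linarith
        qed
        \<comment> \<open>As \<open>r xs = 0\<close>, the Lipschitz bound gives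
          \<open>s \<le> (2 + L) * (D * s powr q)\<close>. This absorbs the inexactness without
          comparing \<open>q\<close> with 1.\<close>
        have "s \<le> r xs + (2 + L) * norm (xs - x)"
          using residual_lipschitz[OF near_in_V[OF small_xs] \<open>x \<in> V\<close>] rx by simp
        also have "\<dots> \<le> (2 + L) * (D * s powr q)"
          using residual_eq_0_of_solution[OF mono xs] dxs L_nonneg
          by (simp add: norm_minus_commute mult_left_mono)
        finally have s_le: "\<nu> * s \<le> E * s powr q"
          using pos by (simp add: E_def mult_left_mono mult.assoc)
        \<comment> \<open>The factor \<open>s powr \<rho>\<close> is kept apart, since it has to
          cancel against \<mu>.\<close>
        have e_le: "norm e \<le> \<nu> * s * s powr \<rho>"
          using st s rx unfolding step_def sub_residual_def e_def y_def H_def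
          by (simp add: powr_add mult.assoc)
        have s\<rho>: "s powr \<rho> \<le> 1"
          using s pos by (simp add: powr_le1)
        have "norm e \<le> \<nu> * s"
          using e_le s\<rho> pos s by (meson mult_left_le mult_nonneg_nonneg less_imp_le order_trans)
        have "norm (DA x e) \<le> (L + \<zeta>) * norm e"
        proof (rule DA_bound)
          have "(2 + L) * norm e \<le> (2 + L) * (\<nu> * s)"
            using \<open>norm e \<le> \<nu> * s\<close> L_nonneg by (intro mult_left_mono) auto
          then show "r x + (2 + L) * norm e < \<epsilon>" using sV(2) rx by linarith
        qed (use \<open>norm e \<le> \<nu> * s\<close> s in linarith)
        moreover have J: "norm (J v - DA x v) \<le> K * s powr \<rho> * norm v" for v
          using J_approx[OF st] s rx by simp
        moreover have "H e = \<mu> *\<^sub>R e + ((J e - DA x e) + DA x e)"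
          by (simp add: H_def damped_apply \<mu>_def rx)
        then have "norm (H e) \<le> \<mu> * norm e + (norm (J e - DA x e) + norm (DA x e))"
          using pos norm_triangle_ineq[of "\<mu> *\<^sub>R e" "(J e - DA x e) + DA x e"]
            norm_triangle_ineq[of "J e - DA x e" "DA x e"] by (simp add: \<mu>_def)
        ultimately have "norm (H e) \<le> (c * s powr \<rho> + K * s powr \<rho> + L + \<zeta>) * norm e"
          using J[of e] unfolding \<mu>_def distrib_right by linarith
        also have "\<dots> \<le> (c + K + L + \<zeta>) * norm e"
          using s\<rho> pos by (intro mult_right_mono add_mono) (auto simp: mult_left_le)
        finally have "norm e + norm (H e) \<le> (1 + c + K + L + \<zeta>) * norm e"
          by (simp add: algebra_simps)
        also have "\<dots> \<le> (1 + c + K + L + \<zeta>) * (E * s powr q * s powr \<rho>)"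
        proof (intro mult_left_mono)
          have "\<nu> * s * s powr \<rho> \<le> E * s powr q * s powr \<rho>"
            using s_le by (intro mult_right_mono) auto
          then show "norm e \<le> E * s powr q * s powr \<rho>" using e_le by linarith
        qed (use pos L_nonneg zeta_nonneg in auto)
        finally have eH: "norm e + norm (H e) \<le> (1 + c + K + L + \<zeta>) * (E * s powr q * s powr \<rho>)" .
        \<comment> \<open>The exponent \<open>(1 + p) * q\<close> is split as
          \<open>(q + p * q - \<rho>) + \<rho>\<close> for the same cancellation.\<close>
        have T: "norm (A xs - A x - DA x (xs - x)) \<le> \<zeta> * (D powr (1 + p) * (s powr (q + p * q - \<rho>) * s powr \<rho>))"
        proof -
          have "norm (xs - x) powr (1 + p) \<le> (D * s powr q) powr (1 + p)"
            using dxs p_pos by (intro powr_mono2) (auto simp: norm_minus_commute)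
          also have "\<dots> = D powr (1 + p) * (s powr (q + p * q - \<rho>) * s powr \<rho>)"
            using nonneg by (simp add: powr_mult powr_powr algebra_simps flip: powr_add)
          finally show ?thesis
            using Taylor[OF small_xs] zeta_nonneg by (meson mult_left_mono order_trans)
        qed
        have d: "(c + K) * s powr \<rho> * norm (x - xs) \<le> (c + K) * s powr \<rho> * (D * s powr q)"
          using dxs pos by (intro mult_left_mono) auto
        have "\<mu> * norm (y - xs) \<le> norm e + norm (H e) + \<mu> * norm (x - xs)
            + norm (J (x - xs) - DA x (x - xs)) + norm (A xs - A x - DA x (xs - x))"
          using damped_distance[OF _ xs, of J x x'] st
          unfolding step_def e_def y_def H_def \<mu>_def rx by blast
        also have "\<dots> \<le> (N * s powr q + \<zeta> * D powr (1 + p) * s powr (q + p * q - \<rho>)) * s powr \<rho>"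
          using eH T d J[of "x - xs"] by (simp add: N_def \<mu>_def algebra_simps)
        finally have "s powr \<rho> * (c * norm (y - xs))
            \<le> s powr \<rho> * (N * s powr q + \<zeta> * D powr (1 + p) * s powr (q + p * q - \<rho>))"
          by (simp add: \<mu>_def mult_ac)
        then have "c * norm (y - xs) \<le> N * s powr q + \<zeta> * D powr (1 + p) * s powr (q + p * q - \<rho>)"
          using s by simp
        then have y: "norm (y - xs) \<le> N / c * s powr q + \<zeta> * D powr (1 + p) / c * s powr (q + p * q - \<rho>)"
          using pos by (simp add: field_simps)
        have "x' - x = e + (y - xs) + (xs - x)" by (simp add: e_def)
        then have "norm (x' - x) \<le> norm e + norm (y - xs) + norm (xs - x)"
          by (metis add_right_mono norm_triangle_ineq order_trans)
        also have "\<dots> \<le> (E + D + N / c) * s powr q + \<zeta> * D powr (1 + p) / c * s powr (q + p * q - \<rho>)"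
          using y dxs s_le \<open>norm e \<le> \<nu> * s\<close> by (simp add: norm_minus_commute distrib_right)
        also have "\<dots> \<le> M * s powr q + M * s powr (q + p * q - \<rho>)"
          using nonneg pos zeta_nonneg by (intro add_mono mult_right_mono) (auto simp: M_def)
        finally show "norm (x' - x) \<le> M * (s powr q + s powr (q + p * q - \<rho>))"
          by (simp add: distrib_left)
      qed
    qed
  qed
  ultimately show ?thesis by blast
qed

lemma q2_pos: "0 < q + p * q - \<rho>"
  using rates(2) p_pos by (smt (verit) mult_nonpos_nonneg)

lemma sbar_pos: "0 < sbar p q \<rho>"
  using rates pos by (simp add: sbar_def)

text \<open>The subproblem's resolvent point \<open>y\<close> and the one defining
  \<open>r x'\<close> differ by at most the difference of their arguments, which consists of a
  Taylor remainder, the damping term and the error of \<open>J\<close>.\<close>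

lemma residual_step_le:
  assumes st: "step x J x'" and "r x \<le> 1" and small: "r x + (2 + L) * norm (x - x') < \<epsilon>"
  shows "r x' \<le> \<nu> * r x powr (1 + \<rho>) + (c + K) * r x powr \<rho> * norm (x' - x)
    + \<zeta> * norm (x' - x) powr (1 + p)"
proof -
  define H where "H = blinfun_apply (damped A B c \<rho> x J)"
  define y where "y = resolvent B ((x' - H x') + (H x - A x))"
  let ?T = "A x' - A x - DA x (x' - x)"
  have H: "H v = (c * r x powr \<rho>) *\<^sub>R v + J v" for v
    by (simp add: H_def damped_apply)
  have e: "norm (x' - y) \<le> \<nu> * r x powr (1 + \<rho>)"
    using st unfolding step_def sub_residual_def y_def H_def by simp
  have "norm (y - resolvent B (x' - A x')) \<le> norm ((x' - H x') + (H x - A x) - (x' - A x'))"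
    unfolding y_def by (rule resolvent_nonexpansive[OF maxmono])
  also have "(x' - H x') + (H x - A x) - (x' - A x')
      = ?T - (c * r x powr \<rho>) *\<^sub>R (x' - x) - (J (x' - x) - DA x (x' - x))"
    by (simp add: H blinfun.diff_right algebra_simps)
  also have "norm \<dots> \<le> norm ?T + norm ((c * r x powr \<rho>) *\<^sub>R (x' - x)) + norm (J (x' - x) - DA x (x' - x))"
    by (intro order_trans[OF norm_triangle_ineq4] add_right_mono norm_triangle_ineq4)
  also have "\<dots> \<le> \<zeta> * norm (x' - x) powr (1 + p) + (c * r x powr \<rho>) * norm (x' - x)
      + K * r x powr \<rho> * norm (x' - x)"
    using Taylor[OF small] J_approx[OF st \<open>r x \<le> 1\<close>] pos by (intro add_mono) auto
  finally have "norm (y - resolvent B (x' - A x')) \<le> \<dots>" .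
  moreover have "r x' \<le> norm (x' - y) + norm (y - resolvent B (x' - A x'))"
    unfolding residual_def using norm_triangle_ineq[of "x' - y" "y - resolvent B (x' - A x')"] by simp
  ultimately show ?thesis
    using e by (simp add: algebra_simps)
qed

text \<open>Insert the step length into \<open>residual_step_le\<close>. The factor
  \<open>s powr \<rho>\<close> yields the exponents \<open>\<rho> + q\<close> and
  \<open>(1 + p) * q\<close>, the power \<open>1 + p\<close> yields \<open>(1 + p) * q\<close> and
  \<open>(q + p * q - \<rho>) * (1 + p)\<close>, and the inexactness \<open>1 + \<rho>\<close>. For
  \<open>s \<le> 1\<close> each may be lowered to the minimum.\<close>

lemma step_rate:
  "\<exists>C. \<forall>\<^sub>F s in at_right 0. \<forall>x J x'. r x = s \<and> step x J x' \<longrightarrow>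
     r x' \<le> C * s powr (1 + sbar p q \<rho>)"
proof -
  obtain M where "M > 0" and M: "\<forall>\<^sub>F s in at_right 0. \<forall>x J x'. r x = s \<and> step x J x' \<longrightarrow>
     norm (x' - x) \<le> M * (s powr q + s powr (q + p * q - \<rho>))"
    using step_length by blast
  let ?m = "q + p * q - \<rho>" and ?k = "1 + sbar p q \<rho>"
  define C where "C = \<nu> + (c + K) * M * 2 + \<zeta> * (M powr (1 + p) * (2 powr (1 + p) * 2))"
  \<comment> \<open>Each of the two terms of the step length may use half of \<epsilon>; the
    coefficient 0 makes the third condition just \<open>s < 1\<close>.\<close>
  have "\<forall>\<^sub>F s in at_right 0. s + ((2 + L) * M) * s powr q < \<epsilon> / 2"
      "\<forall>\<^sub>F s in at_right 0. s + ((2 + L) * M) * s powr ?m < \<epsilon> / 2"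
      "\<forall>\<^sub>F s in at_right 0. s + 0 * s powr 1 < (1::real)"
      "\<forall>\<^sub>F s::real in at_right 0. 0 < s"
    using pos q2_pos by (intro eventually_add_powr_less eventually_at_right_less; simp)+
  with M have "\<forall>\<^sub>F s in at_right 0. \<forall>x J x'. r x = s \<and> step x J x' \<longrightarrow> r x' \<le> C * s powr ?k"
  proof eventually_elim
    case (elim s)
    show ?case
    proof (intro allI impI, elim conjE)
      fix x J x' assume rx: "r x = s" and st: "step x J x'"
      have s: "0 < s" "s \<le> 1" using elim by auto
      have mono_powr: "s powr k \<le> s powr ?k" if "?k \<le> k" for k
        using s that by (intro powr_mono') auto
      let ?g = "s powr q + s powr ?m"
      have len: "norm (x' - x) \<le> M * ?g" using elim(1) rx st by blast
      then have "(2 + L) * norm (x - x') \<le> (2 + L) * (M * ?g)"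
        using L_nonneg by (intro mult_left_mono) (auto simp: norm_minus_commute)
      then have small: "r x + (2 + L) * norm (x - x') < \<epsilon>"
        using elim(2,3) s rx by (simp add: algebra_simps)
      have "r x' \<le> \<nu> * s powr (1 + \<rho>) + (c + K) * s powr \<rho> * norm (x' - x) + \<zeta> * norm (x' - x) powr (1 + p)"
        using residual_step_le[OF st _ small] s rx by simp
      also have "\<dots> \<le> \<nu> * s powr ?k + (c + K) * M * 2 * s powr ?k
          + \<zeta> * (M powr (1 + p) * (2 powr (1 + p) * 2)) * s powr ?k"
      proof (intro add_mono)
        show "\<nu> * s powr (1 + \<rho>) \<le> \<nu> * s powr ?k"
          using pos mono_powr[OF sbar_bounds(4)] by (simp add: mult_left_mono)
        have "s powr \<rho> * ?g = s powr (\<rho> + q) + s powr ((1 + p) * q)"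
          by (simp add: algebra_simps flip: powr_add)
        also have "\<dots> \<le> s powr ?k + s powr ?k"
          by (intro add_mono mono_powr sbar_bounds)
        finally have "(c + K) * M * (s powr \<rho> * ?g) \<le> (c + K) * M * (2 * s powr ?k)"
          using pos \<open>0 < M\<close> by (intro mult_left_mono) auto
        moreover have "(c + K) * s powr \<rho> * norm (x' - x) \<le> (c + K) * s powr \<rho> * (M * ?g)"
          using pos len by (intro mult_left_mono) auto
        ultimately have "(c + K) * s powr \<rho> * norm (x' - x) \<le> (c + K) * M * (2 * s powr ?k)"
          by (simp add: mult_ac)
        then show "(c + K) * s powr \<rho> * norm (x' - x) \<le> (c + K) * M * 2 * s powr ?k"
          by (simp only: mult.assoc)
        have "norm (x' - x) powr (1 + p) \<le> (M * ?g) powr (1 + p)"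
          using len p_pos by (intro powr_mono2) auto
        also have "\<dots> = M powr (1 + p) * ?g powr (1 + p)"
          using \<open>0 < M\<close> by (simp add: powr_mult)
        also have "\<dots> \<le> M powr (1 + p) * (2 powr (1 + p) * ((s powr q) powr (1 + p) + (s powr ?m) powr (1 + p)))"
          using p_pos by (intro mult_left_mono add_powr_le) auto
        also have "\<dots> \<le> M powr (1 + p) * (2 powr (1 + p) * (s powr ?k + s powr ?k))"
          using mono_powr[OF sbar_bounds(1)] mono_powr[OF sbar_bounds(2)]
          by (intro mult_left_mono add_mono) (auto simp: powr_powr mult.commute)
        finally have "\<zeta> * norm (x' - x) powr (1 + p)
            \<le> \<zeta> * (M powr (1 + p) * (2 powr (1 + p) * (s powr ?k + s powr ?k)))"
          using zeta_nonneg by (intro mult_left_mono) auto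
        then show "\<zeta> * norm (x' - x) powr (1 + p)
            \<le> \<zeta> * (M powr (1 + p) * (2 powr (1 + p) * 2)) * s powr ?k"
          by (simp add: mult_ac)
      qed
      also have "\<dots> = C * s powr ?k"
        by (simp add: C_def algebra_simps)
      finally show "r x' \<le> C * s powr ?k" .
    qed
  qed
  then show ?thesis by blast
qed

text \<open>Below a threshold \<open>b\<close> the factor \<open>C * s powr sbar p q \<rho>\<close>
  is at most 1/2, so each step halves the residual. By induction it stays below \<open>b\<close>,
  hence the iterates stay in \<open>V\<close> and the rate holds at every step.\<close>

lemma convergence:
  "\<exists>\<delta>>0. \<forall>J x. newton_like_sequence A DA B c \<nu> \<rho> \<theta> K J x \<and> r (x 0) \<le> \<delta> \<longrightarrow>
     (\<forall>t. x t \<in> V) \<and> Q_superlinear (\<lambda>t. r (x t)) \<and>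
     (\<lambda>t. r (x (Suc t))) \<in> O(\<lambda>t. r (x t) powr (1 + sbar p q \<rho>)) \<and>
     R_superlinear (\<lambda>t. infdist (x t) (solutions A B))"
proof -
  let ?s = "sbar p q \<rho>"
  obtain C where C: "\<forall>\<^sub>F s in at_right 0. \<forall>x J x'. r x = s \<and> step x J x' \<longrightarrow>
     r x' \<le> C * s powr (1 + ?s)"
    using step_rate by blast
  have "\<forall>\<^sub>F s in at_right 0. s + C * s powr ?s < 1 / 2" "\<forall>\<^sub>F s in at_right 0. s + 0 * s powr 1 < \<epsilon>"
    using sbar_pos pos by (intro eventually_add_powr_less; simp)+
  with C have "\<forall>\<^sub>F s in at_right 0. (\<forall>x J x'. r x = s \<and> step x J x' \<longrightarrow>
     r x' \<le> C * s powr (1 + ?s)) \<and> C * s powr ?s \<le> 1 / 2 \<and> s < \<epsilon>"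
    using eventually_at_right_less[of "0::real"] by eventually_elim auto
  then obtain b where "b > 0" and b: "\<And>s. 0 < s \<Longrightarrow> s < b \<Longrightarrow> (\<forall>x J x'. r x = s \<and> step x J x' \<longrightarrow>
     r x' \<le> C * s powr (1 + ?s)) \<and> C * s powr ?s \<le> 1 / 2 \<and> s < \<epsilon>"
    unfolding eventually_at_right_field by blast
  show ?thesis
  proof (intro exI[of _ "b/2"] conjI allI impI; (elim conjE)?)
    show "0 < b / 2" using \<open>b > 0\<close> by simp
    fix J x
    assume seq: "newton_like_sequence A DA B c \<nu> \<rho> \<theta> K J x" and r0: "r (x 0) \<le> b / 2"
    have rate: "r (x (Suc t)) \<le> C * r (x t) powr (1 + ?s) \<and> r (x (Suc t)) \<le> r (x t) / 2"
      if "r (x t) < b" for t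
    proof (cases "r (x t) = 0")
      \<comment> \<open>A stopped run is constant, and \<open>0 powr (1 + ?s) = 0\<close>, so both
        bounds read \<open>0 \<le> 0\<close>.\<close>
      case True
      then show ?thesis using seq by (simp add: newton_like_sequence_def)
    next
      case False
      then have "step (x t) (J t) (x (Suc t))" "0 < r (x t)"
        using seq r_nonneg[of "x t"] by (auto simp: newton_like_sequence_def step_def)
      with b[of "r (x t)"] that have *: "r (x (Suc t)) \<le> C * r (x t) powr (1 + ?s)"
          and half: "C * r (x t) powr ?s \<le> 1 / 2"
        by blast+
      have "C * r (x t) powr (1 + ?s) = C * r (x t) powr ?s * r (x t)"
        using \<open>0 < r (x t)\<close> by (simp add: powr_add)
      also have "\<dots> \<le> 1 / 2 * r (x t)"
        using half \<open>0 < r (x t)\<close> by (intro mult_right_mono) auto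
      finally show ?thesis using * by simp
    qed
    have small: "r (x t) < b" for t
    proof (induction t)
      case 0
      then show ?case using r0 \<open>b > 0\<close> by simp
    next
      case (Suc t)
      then show ?case using rate[of t] r_nonneg[of "x t"] by linarith
    qed
    show inV: "x t \<in> V" for t
      using b[of "r (x t)"] small[of t] r_nonneg[of "x t"] pos by (force simp: V)
    show Q: "Q_superlinear (\<lambda>t. r (x t))"
      using rate small r_nonneg sbar_pos by (intro Q_superlinear_powr_rate) auto
    show "(\<lambda>t. r (x (Suc t))) \<in> O(\<lambda>t. r (x t) powr (1 + ?s))"
      using rate small r_nonneg by (intro bigoI[of _ C]) (auto intro!: always_eventually)
    show "R_superlinear (\<lambda>t. infdist (x t) (solutions A B))"
      unfolding R_superlinear_def
      using Q_superlinear_powr[OF Q pos(8) pos(7)] error_bound[OF inV] infdist_nonneg by blast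
  qed
qed

end

theorem theorem2p4:
  fixes A :: "'a::{real_inner, complete_space} \<Rightarrow> 'a"
    and DA :: "'a \<Rightarrow> 'a \<Rightarrow>\<^sub>L 'a"
    and B :: "'a \<Rightarrow> 'a set"
    and V :: "'a set"
    and c \<nu> \<rho> \<theta> K \<epsilon> \<kappa> q L p \<zeta> :: real
  assumes "\<And>x. (A has_derivative blinfun_apply (DA x)) (at x)"
    and "continuous_on UNIV DA"
    and "maximal_monotone B"
    and "solutions A B \<noteq> {}"
    and "0 < c" and "0 \<le> \<nu>" and "0 < \<rho>" and "\<rho> \<le> \<theta>" and "0 < K"
    and "0 < \<epsilon>" and "0 < \<kappa>" and "0 < q"
    and V: "V = {x. residual A B x \<le> \<epsilon>}"
    and "\<And>x. x \<in> V \<Longrightarrow> infdist x (solutions A B) \<le> \<kappa> * residual A B x powr q"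
    and "L-lipschitz_on V A"
    and "0 < p" and "p \<le> 1" and "0 \<le> \<zeta>"
    and "\<And>x y. x \<in> V \<Longrightarrow> y \<in> V \<Longrightarrow> norm (DA x - DA y) \<le> \<zeta> * norm (x - y) powr p"
    and "(1 + p) * q > 1"
    and "(q + p * q - \<rho>) * (1 + p) > 1"
    and "\<rho> + q > 1"
  shows "sbar p q \<rho> > 0 \<and>
    (\<exists>\<delta>>0. \<forall>J x. newton_like_sequence A DA B c \<nu> \<rho> \<theta> K J x \<and> residual A B (x 0) \<le> \<delta> \<longrightarrow>
       (\<forall>t. x t \<in> V) \<and>
       Q_superlinear (\<lambda>t. residual A B (x t)) \<and>
       (\<lambda>t. residual A B (x (Suc t))) \<in> O(\<lambda>t. residual A B (x t) powr (1 + sbar p q \<rho>)) \<and>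
       R_superlinear (\<lambda>t. infdist (x t) (solutions A B)))"
proof -
  interpret newton_scheme A DA B V \<epsilon> L p \<zeta> c \<nu> \<rho> \<theta> K \<kappa> q
    using assms by unfold_locales auto
  show ?thesis
    using sbar_pos convergence by blast
qed

end
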